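(* Let $F$ be a field, $V$ a non-zero $F$-vector space of finite dimension $n$, and $f:V\times V\to F$ a bilinear form. Suppose that $f$ is non-degenerate and that its asymmetry $\sigma$ has a single elementary divisor $p^n$, where $p=X-1$ or $p=X+1$, and $n\geq 1$. Then either $p=X-1$ and $n$ is odd, or $p=X+1$, $\mathrm{char}(F)\neq 2$ and $n$ is even. Moreover, if $F$ is quadratically closed then the equivalence class of $f$ is uniquely determined by the similarity type of $\sigma$; that is, any non-degenerate bilinear form whose asymmetry is similar to $\sigma$ is equivalent to $f$.
   Context: A field $F$ is quadratically closed if it has no quadratic extensions, i.e. every polynomial of degree 2 over $F$ has a root in $F$. A bilinear form on a finite dimensional space is non-degenerate if its Gram matrices are invertible. Forms $f:V\times V\to F$ and $g:W\times W\to F$ are equivalent if there is a linear isomorphism $x:V\to W$ with $g(xu,xv)=f(u,v)$ for all $u,v\in V$. If $f$ is non-degenerate, its asymmetry is the unique $\sigma\in\mathrm{GL}(V)$ with $f(v,u)=f(u,\sigma v)$ for all $u,v\in V$. Elementary divisors of $\sigma$ are those of $V$ as an $F[X]$-module with $X$ acting as $\sigma$. In characteristic 2 the polynomials $X-1$ and $X+1$ coincide (so there the conclusion is that $n$ is odd). *)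

theory Defs
  imports "Jordan_Normal_Form.Matrix" "HOL-Computational_Algebra.Polynomial"
begin

text \<open>A vector space over \<^typ>\<open>'a::field\<close> is a type \<^typ>\<open>'v::ab_group_add\<close> together with a
  scalar multiplication satisfying the library locale \<^locale>\<open>vector_space\<close>.\<close>

definition quadratically_closed :: "'a::field itself \<Rightarrow> bool" where
  "quadratically_closed _ \<longleftrightarrow> (\<forall>p :: 'a poly. degree p = 2 \<longrightarrow> (\<exists>x. poly p x = 0))"

definition bilinear_form ::
    "('a::field \<Rightarrow> 'v::ab_group_add \<Rightarrow> 'v) \<Rightarrow> ('v \<Rightarrow> 'v \<Rightarrow> 'a) \<Rightarrow> bool" where
  "bilinear_form scale f \<longleftrightarrow>
     (\<forall>u. Vector_Spaces.linear scale (*) (\<lambda>v. f u v)) \<and>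
     (\<forall>v. Vector_Spaces.linear scale (*) (\<lambda>u. f u v))"

definition ordered_basis ::
    "('a::field \<Rightarrow> 'v::ab_group_add \<Rightarrow> 'v) \<Rightarrow> 'v list \<Rightarrow> bool" where
  "ordered_basis scale bs \<longleftrightarrow>
     distinct bs \<and> \<not> Modules.module.dependent scale (set bs) \<and>
     Modules.module.span scale (set bs) = UNIV"

definition gram_mat :: "('v \<Rightarrow> 'v \<Rightarrow> 'a) \<Rightarrow> 'v list \<Rightarrow> 'a mat" where
  "gram_mat f bs = mat (length bs) (length bs) (\<lambda>(i, j). f (bs ! i) (bs ! j))"

text \<open>Only meaningful on finite-dimensional spaces: otherwise there is no ordered basis.\<close>

definition nondegenerate ::
    "('a::field \<Rightarrow> 'v::ab_group_add \<Rightarrow> 'v) \<Rightarrow> ('v \<Rightarrow> 'v \<Rightarrow> 'a) \<Rightarrow> bool" where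
  "nondegenerate scale f \<longleftrightarrow>
     (\<forall>bs. ordered_basis scale bs \<longrightarrow> invertible_mat (gram_mat f bs))"

definition linear_iso ::
    "('a::field \<Rightarrow> 'v::ab_group_add \<Rightarrow> 'v) \<Rightarrow> ('a \<Rightarrow> 'w::ab_group_add \<Rightarrow> 'w) \<Rightarrow> ('v \<Rightarrow> 'w) \<Rightarrow> bool" where
  "linear_iso sV sW x \<longleftrightarrow> Vector_Spaces.linear sV sW x \<and> bij x"

definition equivalent_forms ::
    "('a::field \<Rightarrow> 'v::ab_group_add \<Rightarrow> 'v) \<Rightarrow> ('v \<Rightarrow> 'v \<Rightarrow> 'a) \<Rightarrow>
     ('a \<Rightarrow> 'w::ab_group_add \<Rightarrow> 'w) \<Rightarrow> ('w \<Rightarrow> 'w \<Rightarrow> 'a) \<Rightarrow> bool" where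
  "equivalent_forms sV f sW g \<longleftrightarrow>
     (\<exists>x. linear_iso sV sW x \<and> (\<forall>u v. g (x u) (x v) = f u v))"

definition similar_endos ::
    "('a::field \<Rightarrow> 'v::ab_group_add \<Rightarrow> 'v) \<Rightarrow> ('v \<Rightarrow> 'v) \<Rightarrow>
     ('a \<Rightarrow> 'w::ab_group_add \<Rightarrow> 'w) \<Rightarrow> ('w \<Rightarrow> 'w) \<Rightarrow> bool" where
  "similar_endos sV \<sigma> sW \<tau> \<longleftrightarrow> (\<exists>x. linear_iso sV sW x \<and> (\<forall>v. x (\<sigma> v) = \<tau> (x v)))"

text \<open>Well-defined for non-degenerate forms on finite-dimensional spaces, see
  \<open>asymmetry_unique_existence\<close> below.\<close>

definition asymmetry ::
    "('a::field \<Rightarrow> 'v::ab_group_add \<Rightarrow> 'v) \<Rightarrow> ('v \<Rightarrow> 'v \<Rightarrow> 'a) \<Rightarrow> 'v \<Rightarrow> 'v" where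
  "asymmetry scale f = (THE \<sigma>. linear_iso scale scale \<sigma> \<and> (\<forall>u v. f v u = f u (\<sigma> v)))"

text \<open>The action of \<open>F[X]\<close> on the vector space in which \<open>X\<close> acts as \<open>\<sigma>\<close>.\<close>

definition poly_act ::
    "('a::field \<Rightarrow> 'v::ab_group_add \<Rightarrow> 'v) \<Rightarrow> ('v \<Rightarrow> 'v) \<Rightarrow> 'a poly \<Rightarrow> 'v \<Rightarrow> 'v" where
  "poly_act scale \<sigma> p v = (\<Sum>i\<le>degree p. scale (coeff p i) ((\<sigma> ^^ i) v))"

text \<open>\<open>Q\<close> is the multiset of elementary divisors of \<open>\<sigma>\<close>: its members are positive powers of monic
  irreducible polynomials, and \<open>V\<close> is isomorphic as an \<open>F[X]\<close>-module to the direct sum of the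
  \<open>F[X]/(q)\<close> for \<open>q\<close> in \<open>Q\<close>. The isomorphism is given by the images \<open>vs\<close> of the canonical
  generators: the \<open>F[X]\<close>-linear map from the free module \<open>F[X]\<^sup>k\<close> to \<open>V\<close> sending the \<open>i\<close>-th unit
  vector to \<open>vs ! i\<close> is surjective, and its kernel is the direct sum of the ideals \<open>(qs ! i)\<close>.\<close>

definition has_elementary_divisors ::
    "('a::field \<Rightarrow> 'v::ab_group_add \<Rightarrow> 'v) \<Rightarrow> ('v \<Rightarrow> 'v) \<Rightarrow> 'a poly multiset \<Rightarrow> bool" where
  "has_elementary_divisors scale \<sigma> Q \<longleftrightarrow>
     (\<forall>q \<in># Q. \<exists>p k. Factorial_Ring.irreducible p \<and> lead_coeff p = 1 \<and> 0 < k \<and> q = p ^ k) \<and>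
     (\<exists>qs vs. mset qs = Q \<and> length vs = length qs \<and>
        (\<forall>w. \<exists>r. w = (\<Sum>i<length qs. poly_act scale \<sigma> (r i) (vs ! i))) \<and>
        (\<forall>r. (\<Sum>i<length qs. poly_act scale \<sigma> (r i) (vs ! i)) = 0 \<longleftrightarrow>
             (\<forall>i<length qs. qs ! i dvd r i)))"

context
  fixes scale :: "'a::field \<Rightarrow> 'v::ab_group_add \<Rightarrow> 'v" and B f
  assumes fd: "finite_dimensional_vector_space scale B"
    and bil: "bilinear_form scale f"
    and nondeg: "nondegenerate scale f"
begin

interpretation finite_dimensional_vector_space scale B by (rule fd)

lemma bilinear_simps:
  "f (x + y) z = f x z + f y z" "f z (x + y) = f z x + f z y"
  "f (scale c x) z = c * f x z" "f z (scale c x) = c * f z x"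
  "f (x - y) z = f x z - f y z" "f z (x - y) = f z x - f z y"
  "f (sum g A) z = (\<Sum>i\<in>A. f (g i) z)" "f z (sum g A) = (\<Sum>i\<in>A. f z (g i))"
proof -
  have l: "Vector_Spaces.linear scale (*) (\<lambda>u. f u z)"
    and r: "Vector_Spaces.linear scale (*) (f z)"
    using bil by (auto simp: bilinear_form_def)
  interpret l: Vector_Spaces.linear scale "(*)" "\<lambda>u. f u z" by (rule l)
  interpret r: Vector_Spaces.linear scale "(*)" "f z" by (rule r)
  show "f (x + y) z = f x z + f y z" "f z (x + y) = f z x + f z y"
    "f (scale c x) z = c * f x z" "f z (scale c x) = c * f z x"
    "f (x - y) z = f x z - f y z" "f z (x - y) = f z x - f z y"
    "f (sum g A) z = (\<Sum>i\<in>A. f (g i) z)" "f z (sum g A) = (\<Sum>i\<in>A. f z (g i))"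
    by (rule l.add r.add l.scale r.scale l.diff r.diff l.sum r.sum)+
qed

lemma obtain_inverse_gram:
  obtains bs :: "'v list" and c :: "nat \<Rightarrow> nat \<Rightarrow> 'a" where "set bs = B" "distinct bs"
    "\<And>i j. i < length bs \<Longrightarrow> j < length bs \<Longrightarrow>
       (\<Sum>k<length bs. f (bs ! i) (bs ! k) * c k j) = (if i = j then 1 else 0)"
    "\<And>i j. i < length bs \<Longrightarrow> j < length bs \<Longrightarrow>
       (\<Sum>k<length bs. c i k * f (bs ! k) (bs ! j)) = (if i = j then 1 else 0)"
proof -
  obtain bs where bs: "set bs = B" "distinct bs"
    using finite_distinct_list[OF finite_Basis] by auto
  let ?n = "length bs"
  define A where "A = gram_mat f bs"
  have "ordered_basis scale bs"
    by (simp add: ordered_basis_def bs independent_Basis span_Basis)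
  then have "invertible_mat A" using nondeg by (auto simp: nondegenerate_def A_def)
  moreover have A: "A \<in> carrier_mat ?n ?n" by (simp add: A_def gram_mat_def)
  ultimately obtain C where C1: "A * C = 1\<^sub>m ?n" and C2: "C * A = 1\<^sub>m (dim_row C)"
    by (auto simp: invertible_mat_def inverts_mat_def)
  have "dim_col C = ?n" using arg_cong[OF C1, of dim_col] by simp
  moreover have "dim_row C = ?n" using arg_cong[OF C2, of dim_col] A by simp
  ultimately have C: "C \<in> carrier_mat ?n ?n" by auto
  show ?thesis
  proof (rule that[of bs "\<lambda>i j. C $$ (i, j)"])
    fix i j assume ij: "i < ?n" "j < ?n"
    have "(A * C) $$ (i, j) = (if i = j then 1 else 0)" using C1 ij by simp
    then show "(\<Sum>k<?n. f (bs ! i) (bs ! k) * C $$ (k, j)) = (if i = j then 1 else 0)"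
      using ij A C by (simp add: scalar_prod_def A_def gram_mat_def atLeast0LessThan)
    have "(C * A) $$ (i, j) = (if i = j then 1 else 0)" using C2 C ij by simp
    then show "(\<Sum>k<?n. C $$ (i, k) * f (bs ! k) (bs ! j)) = (if i = j then 1 else 0)"
      using ij A C by (simp add: scalar_prod_def A_def gram_mat_def atLeast0LessThan)
  qed (use bs in auto)
qed

lemma asymmetry_unique_existence:
  "\<exists>!\<sigma>. linear_iso scale scale \<sigma> \<and> (\<forall>u v. f v u = f u (\<sigma> v))"
proof -
  obtain bs c where bs: "set bs = B" "distinct bs"
    and Ac: "\<And>i j. i < length bs \<Longrightarrow> j < length bs \<Longrightarrow>
       (\<Sum>k<length bs. f (bs ! i) (bs ! k) * c k j) = (if i = j then 1 else 0)"
    and cA: "\<And>i j. i < length bs \<Longrightarrow> j < length bs \<Longrightarrow>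
       (\<Sum>k<length bs. c i k * f (bs ! k) (bs ! j)) = (if i = j then 1 else 0)"
    by (rule obtain_inverse_gram) blast
  define n where "n = length bs"
  define b where "b = (\<lambda>i. bs ! i)"
  have expand: "\<exists>x. w = (\<Sum>i<n. scale (x i) (b i))" for w
  proof -
    have "w \<in> span B" by (simp add: span_Basis)
    then obtain y where "w = (\<Sum>v\<in>B. scale (y v) v)"
      using span_finite[OF finite_Basis] by auto
    also have "\<dots> = (\<Sum>i<n. scale (y (b i)) (b i))"
      using bij_betw_nth[OF bs(2) refl bs(1)[symmetric]]
      by (subst sum.reindex_bij_betw[symmetric]) (auto simp: n_def b_def)
    finally show ?thesis by (intro exI[of _ "\<lambda>i. y (b i)"])
  qed
  have inv1: "i < n \<Longrightarrow> j < n \<Longrightarrow> (\<Sum>k<n. f (b i) (b k) * c k j) = (if i = j then 1 else 0)"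
    and inv2: "i < n \<Longrightarrow> j < n \<Longrightarrow> (\<Sum>k<n. c i k * f (b k) (b j)) = (if i = j then 1 else 0)" for i j
    using Ac cA by (auto simp: n_def b_def)
  have right: "w = 0" if w: "\<And>u. f u w = 0" for w
  proof -
    obtain x where x: "w = (\<Sum>i<n. scale (x i) (b i))" using expand by blast
    have "x i = 0" if "i < n" for i
    proof -
      have "x i = (\<Sum>j<n. (\<Sum>k<n. c i k * f (b k) (b j)) * x j)"
        using that by (simp add: inv2 if_distrib[of "\<lambda>t. t * _"] cong: if_cong)
      also have "\<dots> = (\<Sum>k<n. \<Sum>j<n. c i k * f (b k) (b j) * x j)"
        by (subst sum.swap) (simp add: sum_distrib_right)
      also have "\<dots> = (\<Sum>k<n. c i k * f (b k) w)"
        by (simp add: x bilinear_simps sum_distrib_left mult_ac)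
      finally show ?thesis by (simp add: w)
    qed
    then show ?thesis by (simp add: x)
  qed
  have left: "w = 0" if w: "\<And>u. f w u = 0" for w
  proof -
    obtain x where x: "w = (\<Sum>i<n. scale (x i) (b i))" using expand by blast
    have "x i = 0" if "i < n" for i
    proof -
      have "x i = (\<Sum>j<n. (\<Sum>k<n. f (b j) (b k) * c k i) * x j)"
        using that by (simp add: inv1 if_distrib[of "\<lambda>t. t * _"] cong: if_cong)
      also have "\<dots> = (\<Sum>k<n. \<Sum>j<n. f (b j) (b k) * c k i * x j)"
        by (subst sum.swap) (simp add: sum_distrib_right)
      also have "\<dots> = (\<Sum>k<n. c k i * f w (b k))"
        by (simp add: x bilinear_simps sum_distrib_left mult_ac)
      finally show ?thesis by (simp add: w)
    qed
    then show ?thesis by (simp add: x)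
  qed
  have cancel: "w = w'" if "\<And>u. f u w = f u w'" for w w'
    using right[of "w - w'"] that by (simp add: bilinear_simps)
  define \<sigma> where "\<sigma> = (\<lambda>v. \<Sum>j<n. scale (\<Sum>k<n. c j k * f v (b k)) (b j))"
  have basis: "f (b i) (\<sigma> v) = f v (b i)" if "i < n" for i v
  proof -
    have "f (b i) (\<sigma> v) = (\<Sum>j<n. \<Sum>k<n. f (b i) (b j) * c j k * f v (b k))"
      by (simp add: \<sigma>_def bilinear_simps sum_distrib_left mult_ac)
    also have "\<dots> = (\<Sum>k<n. (\<Sum>j<n. f (b i) (b j) * c j k) * f v (b k))"
      by (subst sum.swap) (simp add: sum_distrib_right)
    also have "\<dots> = f v (b i)"
      using that by (simp add: inv1 if_distrib[of "\<lambda>t. t * _"] cong: if_cong)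
    finally show ?thesis .
  qed
  have asym: "f v u = f u (\<sigma> v)" for u v
  proof -
    obtain x where "u = (\<Sum>i<n. scale (x i) (b i))" using expand by blast
    then show ?thesis by (simp add: bilinear_simps basis)
  qed
  have lin: "Vector_Spaces.linear scale scale \<sigma>"
    by unfold_locales (auto intro!: cancel simp: bilinear_simps asym[symmetric])
  have "inj \<sigma>"
  proof (rule injI)
    fix v v' assume "\<sigma> v = \<sigma> v'"
    then have "f v u = f v' u" for u using asym[of v u] asym[of v' u] by simp
    then have "f (v - v') u = 0" for u by (simp add: bilinear_simps)
    then show "v = v'" using left[of "v - v'"] by simp
  qed
  then have "linear_iso scale scale \<sigma>"
    using lin linear_inj_imp_surj[OF lin] by (simp add: linear_iso_def bij_def)
  then show ?thesis using asym cancel by (intro ex1I[of _ \<sigma>]) (auto intro!: ext)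
qed

end

end

(* Let e generate V as an F[X]-module and put N = sigma - eps with eps = 1 or -1. For any bilinear
   form D with D v u = D u (sigma v) that vanishes on V x N^(j+1) V, the form vanishes on V x N^j V
   as soon as D e (N^j e) = 0, and the latter is automatic when j has the wrong parity. Applied to
   f and j = n - 1 this gives the parity of n. For two forms f, g with the same asymmetry, apply it
   to their difference while descending from j = n to j = 0: at each j = n - 1 - 2k of the other
   parity, pull f back along a scalar (k = 0) or along 1 + d T^(k-1) N (k > 0), where
   T = sigma + sigma^(-1) - 2 eps is self-adjoint and T = sigma^(-1) N^2. This changes
   f e (N^j e) by d eps^k f e (N^(n-1) e), with the additional term - d^2 f e (N^(n-1) e) if
   k = 1, so matching the value of g requires at worst solving a quadratic equation. *)
theory Submission
  imports Defs
begin

section \<open>Linear and bilinear maps; roots of monic quadratics\<close>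

lemma linear_simps:
  assumes "Vector_Spaces.linear s1 s2 h"
  shows "h (x + y) = h x + h y" "h (s1 c x) = s2 c (h x)" "h (x - y) = h x - h y"
    "h (- x) = - h x" "h 0 = 0"
proof -
  interpret Vector_Spaces.linear s1 s2 h by (rule assms)
  show "h (x + y) = h x + h y" "h (s1 c x) = s2 c (h x)" "h (x - y) = h x - h y"
    "h (- x) = - h x" "h 0 = 0"
    by (rule add scale diff neg zero)+
qed

lemma bilinear_form_simps:
  assumes "bilinear_form s f"
  shows "f (x + y) z = f x z + f y z" "f z (x + y) = f z x + f z y"
    "f (s c x) z = c * f x z" "f z (s c x) = c * f z x"
    "f (x - y) z = f x z - f y z" "f z (x - y) = f z x - f z y"
    "f (- x) z = - f x z" "f z (- x) = - f z x" "f 0 z = 0" "f z 0 = 0"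
proof -
  have l: "Vector_Spaces.linear s (*) (\<lambda>u. f u z)" and r: "Vector_Spaces.linear s (*) (f z)"
    using assms by (auto simp: bilinear_form_def)
  show "f (x + y) z = f x z + f y z" "f z (x + y) = f z x + f z y"
    "f (s c x) z = c * f x z" "f z (s c x) = c * f z x"
    "f (x - y) z = f x z - f y z" "f z (x - y) = f z x - f z y"
    "f (- x) z = - f x z" "f z (- x) = - f z x" "f 0 z = 0" "f z 0 = 0"
    using linear_simps[OF l] linear_simps[OF r] by simp_all
qed

lemma quadratically_closed_root:
  assumes "quadratically_closed TYPE('a::field)"
  obtains x :: "'a::field" where "x * x + b * x + c = 0"
proof -
  have "degree [:c, b, 1:] = 2" by simp
  then obtain x where "poly [:c, b, 1:] x = 0"
    using assms unfolding quadratically_closed_def by metis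
  then show ?thesis by (intro that[of x]) (simp add: algebra_simps)
qed

section \<open>The cyclic primary module and its nilpotent operator\<close>

locale cyclic_primary = vector_space scale
  for scale :: "'a::field \<Rightarrow> 'v::ab_group_add \<Rightarrow> 'v" +
  fixes \<sigma> :: "'v \<Rightarrow> 'v" and \<epsilon> :: 'a and e :: 'v and n :: nat and N :: "'v \<Rightarrow> 'v"
  defines "N \<equiv> \<lambda>v. \<sigma> v - scale \<epsilon> v"
  assumes linear_\<sigma>: "Vector_Spaces.linear scale scale \<sigma>"
    and bij_\<sigma>: "bij \<sigma>"
    and \<epsilon>_square [simp]: "\<epsilon> * \<epsilon> = 1"
    \<comment> \<open>Modulo the image of \<open>N\<close> the space is spanned by \<open>e\<close>.
      With \<open>nilpotent\<close> this makes it a quotient of F[X]/(X -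
      \<open>\<epsilon>\<close>)^n; that \<open>N ^^ (n - 1)\<close> does not kill \<open>e\<close>
      enters separately, where it matters.\<close>
    and generator: "\<exists>c v'. v = scale c e + N v'"
    and nilpotent: "(N ^^ n) v = 0"
begin

definition \<tau> :: "'v \<Rightarrow> 'v" where "\<tau> = inv_into UNIV \<sigma>"

definition T :: "'v \<Rightarrow> 'v" where "T v = \<sigma> v + \<tau> v - scale (2 * \<epsilon>) v"

text \<open>The condition is linear in \<open>D\<close>, so it passes to the difference of two
  forms, even when that difference is degenerate.\<close>

definition asym_form :: "('v \<Rightarrow> 'v \<Rightarrow> 'a) \<Rightarrow> bool" where
  "asym_form D \<longleftrightarrow> bilinear_form scale D \<and> (\<forall>u v. D v u = D u (\<sigma> v))"

lemmas \<sigma>_simps = linear_simps[OF linear_\<sigma>]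

lemma \<sigma>_\<tau> [simp]: "\<sigma> (\<tau> v) = v" and \<tau>_\<sigma> [simp]: "\<tau> (\<sigma> v) = v"
  using bij_\<sigma> by (simp_all add: \<tau>_def bij_def surj_f_inv_f)

lemma \<tau>_eqI: "\<sigma> y = x \<Longrightarrow> \<tau> x = y"
  by auto

lemma linear_iff_scale:
  "Vector_Spaces.linear scale scale h \<longleftrightarrow>
     (\<forall>x y. h (x + y) = h x + h y) \<and> (\<forall>c x. h (scale c x) = scale c (h x))"
  using vector_space_axioms by (simp add: Vector_Spaces.linear_iff)

lemma linear_\<tau>: "Vector_Spaces.linear scale scale \<tau>"
  by (simp add: linear_iff_scale \<tau>_eqI \<sigma>_simps)

lemmas \<tau>_simps = linear_simps[OF linear_\<tau>]

lemma linear_N: "Vector_Spaces.linear scale scale N"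
  by (simp add: linear_iff_scale N_def \<sigma>_simps algebra_simps)

lemmas N_simps = linear_simps[OF linear_N]

lemma linear_T: "Vector_Spaces.linear scale scale T"
  by (simp add: linear_iff_scale T_def \<sigma>_simps \<tau>_simps algebra_simps)

lemma linear_funpow:
  assumes "Vector_Spaces.linear scale scale h"
  shows "Vector_Spaces.linear scale scale (h ^^ k)"
  using assms by (induction k) (simp_all add: linear_iff_scale)

lemmas Npow_simps = linear_simps[OF linear_funpow[OF linear_N]]
lemmas Tpow_simps = linear_simps[OF linear_funpow[OF linear_T]]

lemma \<epsilon>_mult_\<epsilon> [simp]: "\<epsilon> * (\<epsilon> * x) = x"
  by (simp add: \<epsilon>_square flip: mult.assoc)

lemma \<sigma>_N: "\<sigma> (N v) = N (\<sigma> v)" and \<tau>_N: "\<tau> (N v) = N (\<tau> v)"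
  by (simp_all add: N_def \<sigma>_simps \<tau>_simps)

lemma funpow_comm:
  assumes "\<And>v. h (k v) = k (h v)"
  shows "h ((k ^^ i) v) = (k ^^ i) (h v)"
  using assms by (induction i) simp_all

lemmas \<sigma>_Npow = funpow_comm[of \<sigma> N, OF \<sigma>_N]
lemmas \<tau>_Npow = funpow_comm[of \<tau> N, OF \<tau>_N]

lemma T_\<sigma>: "T (\<sigma> v) = \<sigma> (T v)"
  by (simp add: T_def \<sigma>_simps)

text \<open>The right side expands to sigma - 2 eps + eps^2 sigma^(-1), applied to \<open>v\<close>,
  and eps^2 = 1.\<close>

lemma T_eq: "T v = N (N (\<tau> v))"
  by (simp add: T_def N_def \<sigma>_simps \<tau>_simps algebra_simps \<epsilon>_square
      flip: scale_left_distrib mult_2)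

text \<open>Each \<open>T\<close> raises the power of \<open>N\<close> by two, at the cost of one
  invertible factor \<open>\<tau>\<close>.\<close>

lemma Tpow_Npow: "(T ^^ k) ((N ^^ l) b) = (N ^^ (2 * k + l)) ((\<tau> ^^ k) b)"
proof (induction k)
  case (Suc k)
  have "T ((N ^^ i) x) = (N ^^ Suc (Suc i)) (\<tau> x)" for i x
    by (simp add: T_eq \<tau>_Npow)
  then show ?case using Suc by simp
qed simp

lemma Npow_eq_0: "n \<le> k \<Longrightarrow> (N ^^ k) v = 0"
  using nilpotent[of "(N ^^ (k - n)) v"] funpow_add[of n "k - n" N]
  by (simp add: Npow_simps)

text \<open>The image of \<open>N ^^ k\<close> is killed by \<open>N\<close>, so
  \<open>\<sigma>\<close> acts on it as the scalar \<open>\<epsilon>\<close>, and so does its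
  inverse.\<close>

lemma Npow_\<tau>:
  assumes "n = Suc k"
  shows "(N ^^ k) (\<tau> v) = scale \<epsilon> ((N ^^ k) v)"
proof -
  have "N ((N ^^ k) (\<tau> v)) = 0"
    using nilpotent[of "\<tau> v"] assms by simp
  then have "\<sigma> ((N ^^ k) (\<tau> v)) = scale \<epsilon> ((N ^^ k) (\<tau> v))"
    by (simp add: N_def)
  then have "(N ^^ k) v = scale \<epsilon> ((N ^^ k) (\<tau> v))"
    by (simp add: \<sigma>_Npow)
  then show ?thesis by (metis scale_scale \<epsilon>_square scale_one)
qed

lemma Npow_\<tau>pow:
  assumes "n = Suc k"
  shows "(N ^^ k) ((\<tau> ^^ i) v) = scale (\<epsilon> ^ i) ((N ^^ k) v)"
  by (induction i) (simp_all add: Npow_\<tau>[OF assms])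

section \<open>Forms satisfying the asymmetry identity: adjoints, vanishing, parity\<close>

context
  fixes D assumes D: "asym_form D"
begin

lemmas D_simps = bilinear_form_simps[OF conjunct1[OF D[unfolded asym_form_def]]]

lemma form_asym: "D v u = D u (\<sigma> v)"
  using D by (simp add: asym_form_def)

text \<open>Two uses of the asymmetry identity show that \<open>\<sigma>\<close> preserves
  \<open>D\<close>, so its adjoint is its inverse.\<close>

lemma form_\<sigma>: "D (\<sigma> a) b = D a (\<tau> b)"
  using form_asym[of a "\<tau> b"] form_asym[of "\<tau> b" "\<sigma> a"] by simp

lemma form_\<tau>: "D (\<tau> a) b = D a (\<sigma> b)"
  using form_\<sigma>[of "\<tau> a" "\<sigma> b"] by simp

lemma form_T: "D (T a) b = D a (T b)"
  by (simp add: T_def D_simps form_\<sigma> form_\<tau> algebra_simps)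

lemma form_Tpow: "D ((T ^^ k) a) b = D a ((T ^^ k) b)"
  by (induction k arbitrary: b) (simp_all add: form_T funpow_swap1[symmetric])

text \<open>The adjoint of sigma - eps is sigma^(-1) - eps, and this equals - eps N sigma^(-1)
  because eps^2 = 1.\<close>

lemma form_N: "D (N a) b = - \<epsilon> * D a (N (\<tau> b))"
  by (simp add: N_def D_simps form_\<sigma> algebra_simps)

text \<open>Moving one \<open>N\<close> across replaces \<open>b\<close> by - eps sigma^(-1) b,
  which is - b modulo the image of \<open>N\<close>. The hypothesis kills that error, so each move
  costs only a sign.\<close>

lemma form_Npow_Npow:
  assumes "\<And>a b. D a ((N ^^ Suc (i + l)) b) = 0"
  shows "D ((N ^^ i) a) ((N ^^ l) b) = (- 1) ^ i * D a ((N ^^ (i + l)) b)"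
  using assms
proof (induction i arbitrary: l b)
  case (Suc i)
  have "D ((N ^^ Suc i) a) ((N ^^ l) b)
      = D ((N ^^ i) a) ((N ^^ Suc l) (scale (- \<epsilon>) (\<tau> b)))"
    by (simp add: form_N \<tau>_Npow N_simps Npow_simps D_simps)
  also have "\<dots> = (- 1) ^ i * D a ((N ^^ Suc (i + l)) (scale (- \<epsilon>) (\<tau> b)))"
    using Suc.IH[of "Suc l"] Suc.prems by simp
  also have "scale (- \<epsilon>) (\<tau> b) = N (\<tau> b) - b"
    by (simp add: N_def)
  also have "D a ((N ^^ Suc (i + l)) (N (\<tau> b) - b)) = - D a ((N ^^ Suc (i + l)) b)"
    using Suc.prems[of a "\<tau> b"] by (simp add: N_simps Npow_simps D_simps funpow_swap1)
  finally show ?case by simp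
qed simp

text \<open>Both arguments are multiples of \<open>e\<close> plus an element of the image of
  \<open>N\<close>. An \<open>N\<close> in either argument raises the exponent to j + 1, where
  \<open>D\<close> vanishes; only the term in \<open>e\<close> and \<open>e\<close>
  survives.\<close>

lemma form_vanish_step:
  assumes van: "\<And>a b. D a ((N ^^ Suc j) b) = 0" and ee: "D e ((N ^^ j) e) = 0"
  shows "D a ((N ^^ j) b) = 0"
proof -
  have N0: "D (N x) ((N ^^ j) y) = 0" for x y
    using van[of x "\<tau> y"] by (simp add: form_N \<tau>_Npow)
  have 0: "D x (N ((N ^^ j) y)) = 0" for x y
    using van[of x y] by simp
  obtain c a' d b' where "a = scale c e + N a'" "b = scale d e + N b'"
    using generator by meson
  then show ?thesis
    using ee by (simp add: Npow_simps D_simps N0 0 funpow_swap1[of N, symmetric])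
qed

text \<open>The middle vector \<open>w = N\<^bsup>j div 2\<^esup> e\<close> satisfies \<open>D w w = D w (\<sigma> w)\<close>, which decides the
  value of \<open>D e (N\<^sup>j e)\<close> in every characteristic.\<close>

lemma form_parity:
  assumes van: "\<And>a b. D a ((N ^^ Suc j) b) = 0"
    and par: "\<epsilon> = 1 \<and> odd j \<or> \<epsilon> = - 1 \<and> (2 :: 'a) \<noteq> 0 \<and> even j"
  shows "D e ((N ^^ j) e) = 0"
proof -
  define w where "w = (N ^^ (j div 2)) e"
  have "\<sigma> w = N w + scale \<epsilon> w" by (simp add: N_def)
  then have w: "D w w = D w (N w) + \<epsilon> * D w w"
    using form_asym[of w w] by (simp add: D_simps)
  show ?thesis
  proof (cases "odd j")
    case True
    then have eq: "j div 2 + Suc (j div 2) = j" by presburger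
    \<comment> \<open>For \<open>\<epsilon>\<close> = 1 the two terms \<open>D w w\<close> in the
      fact \<open>w\<close> cancel.\<close>
    have "D w (N w) = 0" using w par True by auto
    moreover have "D w (N w) = (- 1) ^ (j div 2) * D e ((N ^^ j) e)"
      using form_Npow_Npow[of "j div 2" "Suc (j div 2)" e e, unfolded eq, OF van]
      by (simp add: w_def)
    ultimately show ?thesis by simp
  next
    case False
    then have eq: "j div 2 + j div 2 = j" by presburger
    have ww: "D w w = (- 1) ^ (j div 2) * D e ((N ^^ j) e)"
      using form_Npow_Npow[of "j div 2" "j div 2" e e, unfolded eq, OF van]
      by (simp add: w_def)
    \<comment> \<open>Here \<open>D w (N w)\<close> is, up to sign, a value on level j + 1, hence 0,
      and the fact \<open>w\<close> becomes \<open>D w w = - D w w\<close>.\<close>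
    have "N w = (N ^^ Suc (j div 2)) e" by (simp add: w_def)
    moreover have "D ((N ^^ (j div 2)) e) ((N ^^ Suc (j div 2)) e)
        = (- 1) ^ (j div 2) * D e ((N ^^ Suc j) e)"
      using form_Npow_Npow[of "j div 2" "Suc (j div 2)" e e] eq van funpow_swap1[of N]
      by simp
    ultimately have "D w (N w) = 0" using van by (simp add: w_def)
    moreover have "\<epsilon> = - 1" using par False by blast
    ultimately have "2 * D w w = 0"
      by (metis w add_0 add.right_inverse mult_2 mult_minus1)
    then have "D w w = 0" using par False by (metis mult_eq_0_iff)
    with ww show ?thesis by simp
  qed
qed

end

section \<open>Pullbacks along module endomorphisms and the descent\<close>

lemma asym_form_diff: "asym_form f \<Longrightarrow> asym_form g \<Longrightarrow> asym_form (\<lambda>a b. f a b - g a b)"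
  unfolding asym_form_def bilinear_form_def Vector_Spaces.linear_iff
  by (simp add: algebra_simps)

text \<open>These are the F[X]-endomorphisms of the space; pulling back along them keeps the
  asymmetry identity. Bijectivity is recovered in the final theorem from non-degeneracy of
  \<open>f\<close>.\<close>

definition commuting :: "('v \<Rightarrow> 'v) \<Rightarrow> bool" where
  "commuting u \<longleftrightarrow> Vector_Spaces.linear scale scale u \<and> (\<forall>v. u (\<sigma> v) = \<sigma> (u v))"

lemma commuting_comp: "commuting u \<Longrightarrow> commuting u' \<Longrightarrow> commuting (u \<circ> u')"
  by (simp add: commuting_def linear_iff_scale)

lemma asym_form_pullback:
  "asym_form f \<Longrightarrow> commuting u \<Longrightarrow> asym_form (\<lambda>a b. f (u a) (u b))"
  unfolding asym_form_def bilinear_form_def commuting_def Vector_Spaces.linear_iff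
  by metis

text \<open>The linear term in \<open>d\<close> is \<open>N\<close> plus its adjoint, which is N -
  eps sigma^(-1) N = T. The quadratic term is the adjoint of \<open>N\<close> times
  \<open>N\<close>, which is - eps sigma^(-1) N^2 = - eps T.\<close>

lemma form_pullback_correction:
  assumes f: "asym_form f"
  shows "f (a + scale d ((T ^^ m) (N a))) (b + scale d ((T ^^ m) (N b)))
    = f a b + d * f a ((T ^^ Suc m) b) - \<epsilon> * d * d * f a ((T ^^ Suc (2 * m)) b)"
proof -
  note f_simps = D_simps[OF f]
  have NT: "(T ^^ m) (N v) = N ((T ^^ m) v)" for v
    by (rule funpow_comm[symmetric]) (simp add: T_eq \<tau>_N)
  define c where "c = (T ^^ m) b"
  have 1: "f ((T ^^ m) (N a)) b = - \<epsilon> * f a (N (\<tau> c))"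
    by (simp add: form_Tpow[OF f] form_N[OF f] c_def)
  have 2: "f a ((T ^^ m) (N b)) = f a (N c)"
    by (simp add: NT c_def)
  have "(T ^^ m) ((T ^^ m) (N b)) = N ((T ^^ m) c)"
    by (simp add: NT c_def)
  then have 3: "f ((T ^^ m) (N a)) ((T ^^ m) (N b)) = - \<epsilon> * f a (T ((T ^^ m) c))"
    by (simp add: form_Tpow[OF f] form_N[OF f] T_eq \<tau>_N)
  have 4: "T ((T ^^ m) c) = (T ^^ Suc (2 * m)) b"
    by (simp add: c_def mult_2 funpow_add)
  have 5: "- \<epsilon> * f a (N (\<tau> c)) + f a (N c) = f a ((T ^^ Suc m) b)"
    by (simp add: N_def T_def c_def f_simps algebra_simps)
  show ?thesis
    unfolding 4[symmetric] 5[symmetric]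
    by (simp add: f_simps 1 2 3 algebra_simps)
qed

lemma correction_step:
  assumes qc: "quadratically_closed TYPE('a)"
    and f: "asym_form f" and g: "asym_form g"
    and par: "\<epsilon> = 1 \<and> odd n \<or> \<epsilon> = - 1 \<and> (2 :: 'a) \<noteq> 0 \<and> even n"
    and j: "j < n" and top: "f e ((N ^^ (n - 1)) e) \<noteq> 0"
    and eq: "\<And>a b. f a ((N ^^ Suc j) b) = g a ((N ^^ Suc j) b)"
  shows "\<exists>u. commuting u \<and> (\<forall>a b. f (u a) (u ((N ^^ j) b)) = g a ((N ^^ j) b))"
proof -
  note f_simps = D_simps[OF f]
  obtain N' where n: "n = Suc N'" using j by (cases n) auto
  define s where "s = f e ((N ^^ N') e)"
  have s: "s \<noteq> 0" using top n by (simp add: s_def)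
  \<comment> \<open>It suffices to correct the value at the generator, without disturbing the higher levels.\<close>
  have suff: ?thesis if u: "commuting u"
    and hi: "\<And>a b. f (u a) (u ((N ^^ Suc j) b)) = g a ((N ^^ Suc j) b)"
    and ee: "f (u e) (u ((N ^^ j) e)) = g e ((N ^^ j) e)" for u
  proof -
    have D: "asym_form (\<lambda>a b. f (u a) (u b) - g a b)"
      by (rule asym_form_diff[OF asym_form_pullback[OF f u] g])
    have "f (u a) (u ((N ^^ j) b)) - g a ((N ^^ j) b) = 0" for a b
      by (rule form_vanish_step[OF D]) (use hi ee in simp_all)
    with u show ?thesis by auto
  qed
  show ?thesis
  proof (cases "even (N' - j)")
    case False
    have par': "\<epsilon> = 1 \<and> odd j \<or> \<epsilon> = - 1 \<and> (2 :: 'a) \<noteq> 0 \<and> even j"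
      using par False n j by auto
    have "f e ((N ^^ j) e) - g e ((N ^^ j) e) = 0"
      by (rule form_parity[OF asym_form_diff[OF f g] _ par']) (use eq in simp)
    then show ?thesis
      using eq by (intro suff[of id]) (simp_all add: commuting_def linear_iff_scale)
  next
    case True
    then obtain k where k: "N' = 2 * k + j"
      using j n by (metis evenE le_add_diff_inverse2 less_Suc_eq_le)
    show ?thesis
    proof (cases k)
      case 0
      \<comment> \<open>Scaling by \<open>x\<close> multiplies the top value by the square of
        \<open>x\<close>, so \<open>x\<close> is a square root of the quotient of the two top
        values.\<close>
      obtain x where x: "x * x + 0 * x + - (g e ((N ^^ N') e) / s) = 0"
        using quadratically_closed_root[OF qc] .
      have jN: "j = N'" using k 0 by simp
      have "commuting (scale x)"
        by (simp add: commuting_def linear_iff_scale \<sigma>_simps scale_right_distrib mult.commute)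
      moreover have "f (scale x e) (scale x ((N ^^ j) e)) = g e ((N ^^ j) e)"
        using x s unfolding jN by (simp add: f_simps s_def[symmetric] field_simps)
      moreover have "(N ^^ Suc j) b = 0" for b
        using Npow_eq_0[of "Suc j"] n jN by simp
      ultimately show ?thesis
        using D_simps[OF g] by (intro suff[of "scale x"]) (simp_all add: f_simps)
    next
      case (Suc m)
      define r where "r = (g e ((N ^^ j) e) - f e ((N ^^ j) e)) / s"
      \<comment> \<open>The linear correction contributes eps^(m+1) d s. The quadratic one involves
        N^(4m+2+j), which is 0 for m > 0 since n = 2m + 3 + j; for m = 0 it contributes - eps d^2
        eps s = - d^2 s.\<close>
      obtain d where d: "(if m = 0 then \<epsilon> * d - d * d else \<epsilon> ^ Suc m * d) = r"
      proof (cases "m = 0")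
        case True
        obtain x where "x * x + - \<epsilon> * x + r = 0"
          using quadratically_closed_root[OF qc] .
        then show ?thesis using that[of x] True by (simp add: algebra_simps)
      next
        case False
        have "\<epsilon> ^ Suc m * \<epsilon> ^ Suc m = 1"
          by (simp only: \<epsilon>_square power_mult_distrib[symmetric]) simp
        then show ?thesis using that[of "\<epsilon> ^ Suc m * r"] False
          by (simp only: mult.assoc[symmetric]) simp
      qed
      define u where "u = (\<lambda>a. a + scale d ((T ^^ m) (N a)))"
      have Ts: "(T ^^ m) (\<sigma> v) = \<sigma> ((T ^^ m) v)" for v
        by (rule funpow_comm[symmetric]) (simp add: T_\<sigma>)
      have u: "commuting u"
        by (simp add: commuting_def linear_iff_scale u_def N_simps Tpow_simps \<sigma>_simps
            \<sigma>_N[symmetric] Ts algebra_simps)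
      have fu: "f (u a) (u b) = f a b + d * f a ((T ^^ Suc m) b)
          - \<epsilon> * d * d * f a ((T ^^ Suc (2 * m)) b)" for a b
        unfolding u_def by (rule form_pullback_correction[OF f])
      \<comment> \<open>\<open>T ^^ Suc m\<close> supplies 2k powers of \<open>N\<close>, and 2k + j
        + 1 = n, so the correction leaves the levels above j untouched.\<close>
      have "(T ^^ Suc m) ((N ^^ Suc j) b) = 0" "(T ^^ Suc (2 * m)) ((N ^^ Suc j) b) = 0" for b
        unfolding Tpow_Npow by (rule Npow_eq_0; use n k Suc in simp)+
      then have hi: "f (u a) (u ((N ^^ Suc j) b)) = g a ((N ^^ Suc j) b)" for a b
        unfolding fu by (simp only: eq f_simps) simp
      have T1: "(T ^^ Suc m) ((N ^^ j) e) = scale (\<epsilon> ^ Suc m) ((N ^^ N') e)"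
        unfolding Tpow_Npow using Npow_\<tau>pow[OF n, of "Suc m" e] k Suc by simp
      have T2: "(T ^^ Suc (2 * m)) ((N ^^ j) e)
          = (if m = 0 then scale \<epsilon> ((N ^^ N') e) else 0)"
      proof (cases "m = 0")
        case True
        then show ?thesis using T1 by simp
      next
        case False
        then show ?thesis
          unfolding Tpow_Npow by (subst Npow_eq_0) (use n k Suc in auto)
      qed
      have "f (u e) (u ((N ^^ j) e)) = f e ((N ^^ j) e) + r * s"
        unfolding fu T1 T2 d[symmetric] using \<epsilon>_square
        by (simp add: f_simps s_def[symmetric] algebra_simps)
      also have "\<dots> = g e ((N ^^ j) e)" using s by (simp add: r_def)
      finally show ?thesis using u hi suff by blast
    qed
  qed
qed

lemma forms_isometric:
  assumes qc: "quadratically_closed TYPE('a)"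
    and f: "asym_form f" and g: "asym_form g"
    and par: "\<epsilon> = 1 \<and> odd n \<or> \<epsilon> = - 1 \<and> (2 :: 'a) \<noteq> 0 \<and> even n"
    and topf: "f e ((N ^^ (n - 1)) e) \<noteq> 0" and topg: "g e ((N ^^ (n - 1)) e) \<noteq> 0"
  shows "\<exists>u. Vector_Spaces.linear scale scale u \<and> (\<forall>a b. f (u a) (u b) = g a b)"
proof -
  \<comment> \<open>The non-vanishing clause is carried along because the next correction divides by
    the top value of the pulled-back form.\<close>
  let ?P = "\<lambda>j. \<exists>u. commuting u \<and> f (u e) (u ((N ^^ (n - 1)) e)) \<noteq> 0 \<and>
    (\<forall>a b. f (u a) (u ((N ^^ j) b)) = g a ((N ^^ j) b))"
  have "?P 0"
  proof (rule inc_induct[of 0 n ?P])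
    show "?P n"
      using topf
      by (intro exI[of _ id])
        (simp add: commuting_def linear_iff_scale nilpotent D_simps[OF f] D_simps[OF g])
  next
    fix j assume j: "j < n" and "?P (Suc j)"
    then obtain u where u: "commuting u" "f (u e) (u ((N ^^ (n - 1)) e)) \<noteq> 0"
      "\<And>a b. f (u a) (u ((N ^^ Suc j) b)) = g a ((N ^^ Suc j) b)" by blast
    obtain u' where u': "commuting u'"
      "\<And>a b. f (u (u' a)) (u (u' ((N ^^ j) b))) = g a ((N ^^ j) b)"
      using correction_step[OF qc asym_form_pullback[OF f u(1)] g par j u(2,3)] by blast
    \<comment> \<open>The top vector lies in the image of \<open>N ^^ j\<close>, so the new form
      agrees with \<open>g\<close> there and inherits non-vanishing from
      \<open>topg\<close>.\<close>
    have "(N ^^ (n - 1)) e = (N ^^ j) ((N ^^ (n - 1 - j)) e)"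
      using j funpow_add[of j "n - 1 - j" N] by simp
    then have "f (u (u' e)) (u (u' ((N ^^ (n - 1)) e))) \<noteq> 0"
      using topg u'(2) by simp
    then show "?P j"
      using u'(2) commuting_comp[OF u(1) u'(1)] by (intro exI[of _ "u \<circ> u'"]) simp
  qed simp
  then show ?thesis by (auto simp: commuting_def)
qed

section \<open>The top value: non-vanishing and the parity of n\<close>

text \<open>A zero top value would spread, by \<open>form_vanish_step\<close> at level n - 1, to put
  the non-zero vector \<open>(N ^^ (n - 1)) e\<close> in the right radical.\<close>

lemma form_top_nonzero:
  assumes f: "asym_form f" and right: "\<And>w. (\<And>u. f u w = 0) \<Longrightarrow> w = 0"
    and "n \<ge> 1" and top: "(N ^^ (n - 1)) e \<noteq> 0"
  shows "f e ((N ^^ (n - 1)) e) \<noteq> 0"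
proof
  assume *: "f e ((N ^^ (n - 1)) e) = 0"
  have "f a ((N ^^ (n - 1)) b) = 0" for a b
  proof (rule form_vanish_step[OF f _ *])
    show "f a ((N ^^ Suc (n - 1)) b) = 0" for a b
      using nilpotent[of b] \<open>n \<ge> 1\<close> D_simps(10)[OF f] by (simp del: funpow.simps)
  qed
  then show False using right top by blast
qed

text \<open>This is the contrapositive of \<open>form_parity\<close> at j = n - 1, where the next
  level vanishes by nilpotence.\<close>

lemma top_nonzero_parity:
  assumes f: "asym_form f" and "n \<ge> 1" and top: "f e ((N ^^ (n - 1)) e) \<noteq> 0"
  shows "\<epsilon> = 1 \<Longrightarrow> odd n" and "\<epsilon> = - 1 \<Longrightarrow> (2 :: 'a) \<noteq> 0 \<Longrightarrow> even n"
proof -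
  have "f a ((N ^^ Suc (n - 1)) b) = 0" for a b
    using nilpotent[of b] \<open>n \<ge> 1\<close> D_simps(10)[OF f] by (simp del: funpow.simps)
  from form_parity[OF f this] top \<open>n \<ge> 1\<close>
  show "\<epsilon> = 1 \<Longrightarrow> odd n" and "\<epsilon> = - 1 \<Longrightarrow> (2 :: 'a) \<noteq> 0 \<Longrightarrow> even n" by auto
qed

end

section \<open>The action of F[X] and the single elementary divisor\<close>

lemma poly_act_bound:
  assumes "vector_space s" "degree p \<le> d"
  shows "poly_act s \<sigma> p v = (\<Sum>i\<le>d. s (coeff p i) ((\<sigma> ^^ i) v))"
proof -
  interpret vector_space s by (rule assms)
  show ?thesis
    unfolding poly_act_def
    by (rule sum.mono_neutral_left) (use assms(2) in \<open>auto simp: coeff_eq_0\<close>)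
qed

lemma poly_act_pCons:
  assumes "Vector_Spaces.linear s s \<sigma>"
  shows "poly_act s \<sigma> (pCons a q) v = s a v + \<sigma> (poly_act s \<sigma> q v)"
proof -
  interpret Vector_Spaces.linear s s \<sigma> by (rule assms)
  have "poly_act s \<sigma> (pCons a q) v
      = (\<Sum>i\<le>Suc (degree q). s (coeff (pCons a q) i) ((\<sigma> ^^ i) v))"
    by (rule poly_act_bound[OF vs1.vector_space_axioms]) (simp add: degree_pCons_le)
  also have "\<dots> = s a v + \<sigma> (poly_act s \<sigma> q v)"
    by (simp add: sum.atMost_Suc_shift poly_act_def sum scale del: sum.atMost_Suc)
  finally show ?thesis .
qed

lemma poly_act_add:
  assumes "vector_space s"
  shows "poly_act s \<sigma> (p + q) v = poly_act s \<sigma> p v + poly_act s \<sigma> q v"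
proof -
  interpret vector_space s by (rule assms)
  let ?d = "max (degree p) (degree q)"
  show ?thesis
    by (simp add: poly_act_bound[OF assms, of _ ?d] degree_add_le sum.distrib scale_left_distrib)
qed

lemma poly_act_smult:
  assumes "vector_space s"
  shows "poly_act s \<sigma> (smult c p) v = s c (poly_act s \<sigma> p v)"
proof -
  interpret vector_space s by (rule assms)
  show ?thesis
    by (simp add: poly_act_bound[OF assms, of _ "degree p"] degree_smult_le scale_sum_right)
qed

lemma poly_act_linear_factor:
  assumes "Vector_Spaces.linear s s \<sigma>"
  shows "poly_act s \<sigma> ([:- c, 1:] * q) v = \<sigma> (poly_act s \<sigma> q v) - s c (poly_act s \<sigma> q v)"
proof -
  interpret Vector_Spaces.linear s s \<sigma> by (rule assms)
  have "[:- c, 1:] * q = smult (- c) q + pCons 0 q" by simp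
  then show ?thesis
    by (simp only: poly_act_add[OF vs1.vector_space_axioms]
        poly_act_smult[OF vs1.vector_space_axioms] poly_act_pCons[OF assms]) simp
qed

lemma poly_act_linear_factor_power:
  assumes "Vector_Spaces.linear s s \<sigma>"
  shows "poly_act s \<sigma> ([:- c, 1:] ^ k * q) v
    = ((\<lambda>v. \<sigma> v - s c v) ^^ k) (poly_act s \<sigma> q v)"
  by (induction k) (simp_all only: power_0 mult_1 power_Suc mult.assoc
      poly_act_linear_factor[OF assms] funpow.simps id_apply comp_apply)

text \<open>A single elementary divisor means one generator \<open>e\<close>, whose annihilator is
  generated by the n-th power. That this power does not divide the (n-1)-st gives the non-vanishing
  claim.\<close>

lemma cyclic_primary_of_elementary_divisor:
  assumes lin: "Vector_Spaces.linear s s \<sigma>" and bij: "bij \<sigma>" and \<epsilon>: "\<epsilon> * \<epsilon> = 1"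
    and n: "n \<ge> 1" and ed: "has_elementary_divisors s \<sigma> {#[:- \<epsilon>, 1:] ^ n#}"
  obtains e where "cyclic_primary s \<sigma> \<epsilon> e n"
    "((\<lambda>v. \<sigma> v - s \<epsilon> v) ^^ (n - 1)) e \<noteq> 0"
proof -
  interpret Vector_Spaces.linear s s \<sigma> by (rule lin)
  let ?p = "[:- \<epsilon>, 1:]" and ?N = "\<lambda>v. \<sigma> v - s \<epsilon> v"
  obtain qs vs where qs: "mset qs = {#?p ^ n#}" and len: "length vs = length qs"
    and gen: "\<forall>w. \<exists>r. w = (\<Sum>i<length qs. poly_act s \<sigma> (r i) (vs ! i))"
    and ker: "\<forall>r. (\<Sum>i<length qs. poly_act s \<sigma> (r i) (vs ! i)) = 0 \<longleftrightarrow>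
             (\<forall>i<length qs. qs ! i dvd r i)"
    using ed unfolding has_elementary_divisors_def by blast
  have qs: "qs = [?p ^ n]" using qs by simp
  define e where "e = vs ! 0"
  have gen: "\<exists>r. w = poly_act s \<sigma> r e" for w
    using gen[rule_format, of w] by (auto simp: qs e_def)
  have ker: "poly_act s \<sigma> r e = 0 \<longleftrightarrow> ?p ^ n dvd r" for r
    using ker[rule_format, of "\<lambda>_. r"] by (simp add: qs e_def)
  have one: "poly_act s \<sigma> 1 v = v" for v
    by (simp add: poly_act_def)
  have "cyclic_primary s \<sigma> \<epsilon> e n"
  proof
    fix v
    obtain r where r: "v = poly_act s \<sigma> r e" using gen by blast
    \<comment> \<open>The remainder theorem splits \<open>r\<close> into its value at
      \<open>\<epsilon>\<close>, acting as a scalar, and a multiple of X -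
      \<open>\<epsilon>\<close>, acting through \<open>?N\<close>.\<close>
    have "?p dvd r - [:poly r \<epsilon>:]" by (simp add: dvd_iff_poly_eq_0)
    then obtain q where "r - [:poly r \<epsilon>:] = ?p * q" by (rule dvdE)
    then have "r = [:poly r \<epsilon>:] + ?p * q" by (simp add: algebra_simps)
    then have "v = poly_act s \<sigma> ([:poly r \<epsilon>:] + ?p * q) e" using r by simp
    also have "\<dots> = s (poly r \<epsilon>) e + ?N (poly_act s \<sigma> q e)"
      by (simp only: poly_act_add[OF vs1.vector_space_axioms] poly_act_linear_factor[OF lin])
        (simp add: poly_act_def)
    finally show "\<exists>c v'. v = s c e + ?N v'" by blast
    have "(?N ^^ n) v = poly_act s \<sigma> (?p ^ n * r) e"
      by (simp only: poly_act_linear_factor_power[OF lin] r)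
    also have "\<dots> = 0" by (simp only: ker dvd_triv_left)
    finally show "(?N ^^ n) v = 0" .
  qed (use bij \<epsilon> in auto)
  moreover have "(?N ^^ (n - 1)) e \<noteq> 0"
  proof
    assume "(?N ^^ (n - 1)) e = 0"
    then have "poly_act s \<sigma> (?p ^ (n - 1) * 1) e = 0"
      by (simp only: poly_act_linear_factor_power[OF lin] one)
    then have "?p ^ n dvd ?p ^ (n - 1)" using ker by simp
    then have "degree (?p ^ n) \<le> degree (?p ^ (n - 1))"
      by (intro dvd_imp_degree_le) auto
    then show False using n by (simp add: degree_linear_power)
  qed
  ultimately show ?thesis by (rule that)
qed

section \<open>Both radicals of a non-degenerate form vanish\<close>

context
  fixes s :: "'a::field \<Rightarrow> 'v::ab_group_add \<Rightarrow> 'v" and B f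
  assumes fd: "finite_dimensional_vector_space s B"
    and bil: "bilinear_form s f"
    and nondeg: "nondegenerate s f"
begin

lemma asymmetry_linear_iso: "linear_iso s s (asymmetry s f)"
  and asymmetry_eq: "f v u = f u (asymmetry s f v)"
  using theI'[OF asymmetry_unique_existence[OF fd bil nondeg]]
  unfolding asymmetry_def[symmetric] by auto

text \<open>The inverse Gram matrix \<open>c\<close> recovers the coordinates of \<open>w\<close>
  from the values of \<open>f\<close> at basis vectors and \<open>w\<close>.\<close>

lemma nondegenerate_right:
  assumes w: "\<And>u. f u w = 0"
  shows "w = 0"
proof -
  interpret finite_dimensional_vector_space s B by (rule fd)
  obtain bs c where bs: "set bs = B" "distinct bs"
    and cA: "\<And>i j. i < length bs \<Longrightarrow> j < length bs \<Longrightarrow>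
       (\<Sum>k<length bs. c i k * f (bs ! k) (bs ! j)) = (if i = j then 1 else 0)"
    by (rule obtain_inverse_gram[OF fd bil nondeg]) blast
  let ?n = "length bs"
  have "w \<in> span B" by (simp add: span_Basis)
  then obtain y where "w = (\<Sum>v\<in>B. s (y v) v)"
    using span_finite[OF finite_Basis] by auto
  also have "\<dots> = (\<Sum>i<?n. s (y (bs ! i)) (bs ! i))"
    using bij_betw_nth[OF bs(2) refl bs(1)[symmetric]]
    by (subst sum.reindex_bij_betw[symmetric]) auto
  finally have y: "w = (\<Sum>i<?n. s (y (bs ! i)) (bs ! i))" .
  have fw: "f v w = (\<Sum>j<?n. y (bs ! j) * f v (bs ! j))" for v
    using arg_cong[OF y, of "f v"] by (simp add: bilinear_simps[OF fd bil nondeg])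
  have "y (bs ! i) = 0" if "i < ?n" for i
  proof -
    have "y (bs ! i) = (\<Sum>j<?n. (\<Sum>k<?n. c i k * f (bs ! k) (bs ! j)) * y (bs ! j))"
      using that by (simp add: cA if_distrib[of "\<lambda>t. t * _"] cong: if_cong)
    also have "\<dots> = (\<Sum>k<?n. c i k * (\<Sum>j<?n. y (bs ! j) * f (bs ! k) (bs ! j)))"
      unfolding sum_distrib_left sum_distrib_right by (subst sum.swap) (simp add: mult_ac)
    also have "\<dots> = (\<Sum>k<?n. c i k * f (bs ! k) w)"
      by (simp add: fw)
    finally show ?thesis by (simp add: w)
  qed
  then show ?thesis by (simp add: y)
qed

text \<open>The asymmetry maps the left radical into the right one and is injective.\<close>

lemma nondegenerate_left:
  assumes w: "\<And>u. f w u = 0"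
  shows "w = 0"
proof -
  have "asymmetry s f w = 0"
    using w asymmetry_eq[of w] by (intro nondegenerate_right) simp
  moreover have "asymmetry s f 0 = 0" "inj (asymmetry s f)"
    using asymmetry_linear_iso linear_simps(5) by (auto simp: linear_iso_def bij_def)
  ultimately show ?thesis by (metis injD)
qed

end

section \<open>Parity of n and uniqueness of the form\<close>

theorem theorem6p1:
  fixes sV :: "'a::field \<Rightarrow> 'v::ab_group_add \<Rightarrow> 'v"
    and BV :: "'v set"
    and f :: "'v \<Rightarrow> 'v \<Rightarrow> 'a"
    and p :: "'a poly"
    and n :: nat
  assumes "finite_dimensional_vector_space sV BV"
    and "n = vector_space.dim sV (UNIV :: 'v set)"
    and "\<exists>v::'v. v \<noteq> 0"
    and "n \<ge> 1"
    and "bilinear_form sV f"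
    and "nondegenerate sV f"
    and "p = [:-1, 1:] \<or> p = [:1, 1:]"
    and "has_elementary_divisors sV (asymmetry sV f) {#p ^ n#}"
  shows "((p = [:-1, 1:] \<and> odd n) \<or> (p = [:1, 1:] \<and> CHAR('a) \<noteq> 2 \<and> even n)) \<and>
    (quadratically_closed TYPE('a) \<longrightarrow>
      (\<forall>(sW :: 'a \<Rightarrow> 'w::ab_group_add \<Rightarrow> 'w) BW g.
         finite_dimensional_vector_space sW BW \<longrightarrow>
         bilinear_form sW g \<longrightarrow>
         nondegenerate sW g \<longrightarrow>
         similar_endos sV (asymmetry sV f) sW (asymmetry sW g) \<longrightarrow>
         equivalent_forms sV f sW g))"
proof -
  interpret V: finite_dimensional_vector_space sV BV by (rule assms(1))
  define \<sigma> where "\<sigma> = asymmetry sV f"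
  have two: "(2 :: 'a) = 0 \<longleftrightarrow> CHAR('a) = 2"
  proof -
    have "(2 :: 'a) = 0 \<longleftrightarrow> CHAR('a) dvd 2"
      using of_nat_eq_0_iff_char_dvd[of 2, where 'a = 'a] by simp
    also have "\<dots> \<longleftrightarrow> CHAR('a) = 2"
      using CHAR_not_1[where 'a = 'a]
      by (cases "CHAR('a) = 0") (auto dest!: dvd_imp_le simp: numeral_2_eq_2 le_Suc_eq)
    finally show ?thesis .
  qed
  have \<sigma>: "linear_iso sV sV \<sigma>" "f v u = f u (\<sigma> v)" for u v
    using asymmetry_linear_iso[OF assms(1,5,6)] asymmetry_eq[OF assms(1,5,6)]
    by (simp_all add: \<sigma>_def)
  \<comment> \<open>When 2 = 0 the two polynomials coincide and \<open>\<epsilon>\<close> is taken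
    to be 1, so the value - 1 always comes with 2 non-zero.\<close>
  obtain \<epsilon> :: 'a where p: "p = [:- \<epsilon>, 1:]" and \<epsilon>: "\<epsilon> = 1 \<or> \<epsilon> = - 1 \<and> (2 :: 'a) \<noteq> 0"
  proof (cases "p = [:- 1, 1:]")
    case True
    then show ?thesis using that[of 1] by simp
  next
    case False
    then have p: "p = [:- (- 1), 1:]" using assms(7) by simp
    have "(2 :: 'a) \<noteq> 0"
    proof
      assume "(2 :: 'a) = 0"
      then have "(1 :: 'a) = - 1" by (simp add: eq_neg_iff_add_eq_0)
      with p False show False by metis
    qed
    with p show ?thesis using that[of "- 1"] by blast
  qed
  have "\<epsilon> * \<epsilon> = 1" using \<epsilon> by auto
  then obtain e where "cyclic_primary sV \<sigma> \<epsilon> e n"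
    and top: "((\<lambda>v. \<sigma> v - sV \<epsilon> v) ^^ (n - 1)) e \<noteq> 0"
    using cyclic_primary_of_elementary_divisor[of sV \<sigma> \<epsilon> n] \<sigma>(1) assms(4,8)
    unfolding p linear_iso_def \<sigma>_def by blast
  then interpret cyclic_primary sV \<sigma> \<epsilon> e n "\<lambda>v. \<sigma> v - sV \<epsilon> v" by simp
  have f: "asym_form f" using assms(5) \<sigma>(2) unfolding asym_form_def by blast
  have topf: "f e (((\<lambda>v. \<sigma> v - sV \<epsilon> v) ^^ (n - 1)) e) \<noteq> 0"
    by (rule form_top_nonzero[OF f nondegenerate_right[OF assms(1,5,6)] assms(4) top])
  have par: "\<epsilon> = 1 \<and> odd n \<or> \<epsilon> = - 1 \<and> (2 :: 'a) \<noteq> 0 \<and> even n"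
    using top_nonzero_parity[OF f assms(4) topf] \<epsilon> by blast
  have "equivalent_forms sV f sW g"
    if qc: "quadratically_closed TYPE('a)" and W: "finite_dimensional_vector_space sW BW"
      "bilinear_form sW g" "nondegenerate sW g"
      and sim: "similar_endos sV (asymmetry sV f) sW (asymmetry sW g)"
    for sW :: "'a \<Rightarrow> 'w \<Rightarrow> 'w" and BW g
  proof -
    obtain x where x: "Vector_Spaces.linear sV sW x" "bij x"
      and comm: "x (\<sigma> v) = asymmetry sW g (x v)" for v
      using sim by (auto simp: similar_endos_def linear_iso_def \<sigma>_def)
    \<comment> \<open>Since \<open>x\<close> intertwines the two asymmetries, the form
      \<open>g\<close> transported to the first space satisfies the identity for the same
      \<open>\<sigma>\<close>.\<close>
    have g: "asym_form (\<lambda>a b. g (x a) (x b))"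
      unfolding asym_form_def
    proof (intro conjI allI)
      show "bilinear_form sV (\<lambda>a b. g (x a) (x b))"
        using W(2) x(1) unfolding bilinear_form_def Vector_Spaces.linear_iff by simp
      show "g (x v) (x u) = g (x u) (x (\<sigma> v))" for u v
        using asymmetry_eq[OF W] comm by simp
    qed
    have "w = 0" if "\<And>u. g (x u) (x w) = 0" for w
    proof -
      have "g u (x w) = 0" for u using that x(2) by (metis bij_pointE)
      then have "x w = 0" by (rule nondegenerate_right[OF W])
      then show ?thesis using x linear_simps(5)[OF x(1)] by (metis bij_pointE)
    qed
    then have "g (x e) (x (((\<lambda>v. \<sigma> v - sV \<epsilon> v) ^^ (n - 1)) e)) \<noteq> 0"
      by (rule form_top_nonzero[OF g _ assms(4) top])
    \<comment> \<open>The roles are exchanged: the transported \<open>g\<close> is pulled back to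
      \<open>f\<close>, so that \<open>x \<circ> u\<close> is the desired equivalence.\<close>
    then obtain u where u: "Vector_Spaces.linear sV sV u"
      and iso: "\<And>a b. g (x (u a)) (x (u b)) = f a b"
      using forms_isometric[OF qc g f par _ topf] by blast
    have "inj u"
    proof (rule injI)
      fix a b assume "u a = u b"
      then have "f a c = f b c" for c by (metis iso)
      then have "f (a - b) c = 0" for c by (simp add: D_simps[OF f])
      then have "a - b = 0" by (rule nondegenerate_left[OF assms(1,5,6)])
      then show "a = b" by simp
    qed
    then have "bij u" using V.linear_inj_imp_surj[OF u] by (simp add: bij_def)
    then have "linear_iso sV sW (x \<circ> u)"
      using x u by (simp add: linear_iso_def bij_comp Vector_Spaces.linear_compose)
    then show ?thesis using iso by (auto simp: equivalent_forms_def)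
  qed
  moreover have "(p = [:-1, 1:] \<and> odd n) \<or> (p = [:1, 1:] \<and> CHAR('a) \<noteq> 2 \<and> even n)"
    using par p two by auto
  ultimately show ?thesis by blast
qed

end
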